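(* Let $1\le m<n$, $M\in C(\mathbb{R}^n\to\mathbf{Gl}_n(\mathbb{R}))$, $B\in C(\mathbb{R}^n\to\mathbb{R}^{n\times m})$, $h\in C^1(\mathbb{R}^n\to\mathbb{R}^m)$, $H(x_1):=h'(x_1)$. Let $U_1\subseteq\mathbb{R}^n$ be open with $\Gamma(x_1):=H(x_1)M(x_1)^{-1}B(x_1)\in\mathbf{Gl}_m(\mathbb{R})$ for all $x_1\in U_1$. Consider functions $\phi_2:U_1\to\mathbb{R}^{(n-m)\times n}$ satisfying, for all $x_1\in U_1$, $$\begin{bmatrix}H(x_1)\\ \phi_2(x_1)\end{bmatrix}\in\mathbf{Gl}_n(\mathbb{R})\quad\text{and}\quad\phi_2(x_1)M(x_1)^{-1}B(x_1)=0.\qquad(\ast)$$ Then $\phi_2$ is uniquely determined by $(\ast)$ up to an invertible left transformation, i.e. if $\phi_2$ and $\tilde\phi_2$ both satisfy $(\ast)$, there is $R:U_1\to\mathbf{Gl}_{n-m}(\mathbb{R})$ with $\tilde\phi_2(x_1)=R(x_1)^{-1}\phi_2(x_1)$ for all $x_1\in U_1$. Moreover, all functions satisfying $(\ast)$ are given by $$\phi_2(x_1)=V^\dagger(x_1)\big(I_n-M(x_1)^{-1}B(x_1)\Gamma(x_1)^{-1}H(x_1)\big),\qquad x_1\in U_1,$$ where $V:U_1\to\mathbb{R}^{n\times(n-m)}$ is such that, for some $P:U_1\to\mathbb{R}^{n\times m}$, $$[P(x_1),V(x_1)]\begin{bmatrix}H(x_1)\\ \phi_2(x_1)\end{bmatrix}=I_n\quad\text{for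 all }x_1\in U_1.$$
   Context: $\mathbf{Gl}_k(\mathbb{R})$ is the group of invertible real $k\times k$ matrices. $V^\dagger(x_1)=(V(x_1)^\top V(x_1))^{-1}V(x_1)^\top$ is the pseudoinverse of $V(x_1)$ (which has full column rank). The data come from the multibody system $\dot q=v$, $M(q)\dot v=f(q,v)+B(q)u$, $y=h(q)$. *)

theory Defs
  imports "HOL-Analysis.Analysis"
begin

text \<open>
  The row index of the stacked matrix \<open>[A; B]\<close> and the column index of \<open>[P, V]\<close> is the
  disjoint sum of the index types of the blocks, the summand \<open>Inl\<close> belonging to the first block.
  If the cardinalities add up, such a matrix is square without having literally equal row and
  column index types; the library's \<^const>\<open>invertible\<close> asks for a two-sided inverse and does
  not require these types to coincide.
\<close>

definition vstack :: "'a ^ 'n ^ 'm::finite \<Rightarrow> 'a ^ 'n ^ 'k::finite \<Rightarrow> 'a ^ 'n ^ ('m + 'k)" where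
  "vstack A B = (\<chi> i. case i of Inl r \<Rightarrow> A $ r | Inr s \<Rightarrow> B $ s)"

definition hstack :: "'a ^ 'm::finite ^ 'n \<Rightarrow> 'a ^ 'k::finite ^ 'n \<Rightarrow> 'a ^ ('m + 'k) ^ 'n" where
  "hstack P V = (\<chi> i j. case j of Inl r \<Rightarrow> P $ i $ r | Inr s \<Rightarrow> V $ i $ s)"

definition C1_map :: "(real ^ 'n \<Rightarrow> real ^ 'm) \<Rightarrow> bool" where
  "C1_map h \<longleftrightarrow> h differentiable_on UNIV \<and> continuous_on UNIV (\<lambda>x. jacobian h (at x))"

text \<open>This is the pseudoinverse only for \<open>V\<close> of full column rank; otherwise the inverse is unspecified.\<close>

definition pinv :: "real ^ 'k ^ 'n \<Rightarrow> real ^ 'n ^ 'k" where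
  "pinv V = matrix_inv (transpose V ** V) ** transpose V"

definition Gam ::
  "(real ^ 'n \<Rightarrow> real ^ 'n ^ 'n) \<Rightarrow> (real ^ 'n \<Rightarrow> real ^ 'm ^ 'n) \<Rightarrow> (real ^ 'n \<Rightarrow> real ^ 'm)
    \<Rightarrow> real ^ 'n \<Rightarrow> real ^ 'm ^ 'm" where
  "Gam M B h x = jacobian h (at x) ** matrix_inv (M x) ** B x"

text \<open>\<open>\<phi>\<close> stands for a function on \<open>U\<close>; its values outside \<open>U\<close> are irrelevant.\<close>

definition admissible ::
  "(real ^ 'n \<Rightarrow> real ^ 'n ^ 'n) \<Rightarrow> (real ^ 'n \<Rightarrow> real ^ 'm ^ 'n) \<Rightarrow> (real ^ 'n \<Rightarrow> real ^ 'm)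
    \<Rightarrow> (real ^ 'n) set \<Rightarrow> (real ^ 'n \<Rightarrow> real ^ 'n ^ 'k) \<Rightarrow> bool" where
  "admissible M B h U \<phi> \<longleftrightarrow>
    (\<forall>x\<in>U. invertible (vstack (jacobian h (at x)) (\<phi> x)) \<and> \<phi> x ** matrix_inv (M x) ** B x = 0)"

end

theory Submission
  imports Defs
begin

text \<open>
  Fix a point and write \<open>G = M\<^sup>-\<^sup>1B\<close>, so that \<open>\<Gamma> = HG\<close> is invertible. If \<open>\<phi>G = 0\<close> and
  \<open>PH + V\<phi> = I\<close>, multiplying by \<open>G\<close> from the right gives \<open>P = G\<Gamma>\<^sup>-\<^sup>1\<close>, hence
  \<open>V\<phi> = I - G\<Gamma>\<^sup>-\<^sup>1H\<close>. This is independent of \<open>\<phi>\<close>, and since the stacked matrix is square also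
  \<open>HV = 0\<close> and \<open>\<phi>V = I\<close>. So \<open>V\<close> has full column rank, \<open>V\<^sup>\<dagger>\<close> recovers \<open>\<phi>\<close>, and a
  second solution \<open>\<psi>\<close> satisfies \<open>\<psi> = \<psi>(I - G\<Gamma>\<^sup>-\<^sup>1H) = (\<psi>V)\<phi>\<close>.
\<close>

section \<open>Matrix inverses and the pseudoinverse\<close>

lemma matrix_inv_mult:
  assumes "invertible A"
  shows "A ** matrix_inv A = mat 1" and "matrix_inv A ** A = mat 1"
  using someI_ex[OF assms[unfolded invertible_def]] unfolding matrix_inv_def by auto

lemma matrix_inv_unique:
  fixes A :: "'a::semiring_1 ^ 'n ^ 'm" and A' :: "'a ^ 'm ^ 'n"
  assumes "A ** A' = mat 1" and "A' ** A = mat 1"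
  shows "matrix_inv A = A'"
proof -
  have "invertible A"
    using assms by (auto simp: invertible_def)
  then show ?thesis
    by (metis assms(2) matrix_inv_mult(1) matrix_mul_assoc matrix_mul_lid matrix_mul_rid)
qed

lemma matrix_diff_ldistrib:
  fixes A :: "'a::ring_1 ^ 'n ^ 'm"
  shows "A ** (B - C) = A ** B - A ** C"
  by (simp add: vec_eq_iff matrix_matrix_mult_def algebra_simps sum_subtractf)

lemma matrix_diff_rdistrib:
  fixes A :: "'a::ring_1 ^ 'n ^ 'm"
  shows "(A - B) ** C = A ** C - B ** C"
  by (simp add: vec_eq_iff matrix_matrix_mult_def algebra_simps sum_subtractf)

lemma matrix_add_rdistrib:
  fixes A :: "'a::semiring_1 ^ 'n ^ 'm"
  shows "(A + B) ** C = A ** C + B ** C"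
  by (simp add: vec_eq_iff matrix_matrix_mult_def algebra_simps sum.distrib)

text \<open>Squareness is a condition on cardinalities because the stacked matrix has rows indexed
  by \<open>'m + 'k\<close> and columns by \<open>'n\<close>. A left inverse makes \<open>A\<close>
  injective, hence of full rank and surjective; the resulting right inverse must then equal
  \<open>A'\<close>.\<close>

lemma left_inverse_imp_right_inverse:
  fixes A :: "real ^ 'n ^ 'm"
  assumes card: "CARD('n) = CARD('m)" and left: "A' ** A = mat 1"
  shows "A ** A' = mat 1"
proof -
  have "inj ((*v) A)"
    using left matrix_left_invertible_injective by blast
  then have "surj ((*v) A)"
    using card by (metis full_rank_injective full_rank_surjective)
  then obtain C where "A ** C = mat 1"
    using matrix_right_invertible_surjective by blast
  then show ?thesis
    by (metis left matrix_mul_assoc matrix_mul_lid matrix_mul_rid)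
qed

text \<open>The inner product of \<open>(transpose V ** V) *v x\<close> with \<open>x\<close> is the
  squared norm of \<open>V *v x\<close>, so the Gram matrix has the same kernel as \<open>V\<close>,
  which is trivial.\<close>

lemma left_inverse_imp_invertible_gram:
  fixes V :: "real ^ 'k ^ 'n"
  assumes "W ** V = mat 1"
  shows "invertible (transpose V ** V)"
proof -
  have inj: "inj ((*v) V)"
    using assms matrix_left_invertible_injective by blast
  have "x = 0" if "(transpose V ** V) *v x = 0" for x
  proof -
    have "inner (V *v x) (V *v x) = inner ((V *v x) v* V) x"
      by (simp only: dot_lmul_matrix)
    also have "\<dots> = inner ((transpose V ** V) *v x) x"
      by (simp flip: matrix_vector_mul_assoc)
    finally have "V *v x = V *v 0"
      using that by simp
    then show "x = 0"
      using inj by (simp only: inj_eq)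
  qed
  then show ?thesis
    by (simp add: invertible_left_inverse matrix_left_invertible_ker)
qed

text \<open>Any left inverse \<open>W\<close> witnesses full column rank, so the inverse inside
  \<open>pinv\<close> is a genuine one; \<open>W\<close> itself may differ from
  \<open>pinv V\<close>.\<close>

lemma pinv_left_inverse:
  assumes "W ** V = mat 1"
  shows "pinv V ** V = mat 1"
  using matrix_inv_mult(2)[OF left_inverse_imp_invertible_gram[OF assms]]
  by (simp add: pinv_def matrix_mul_assoc)

section \<open>Stacked matrices and their block inverses\<close>

lemma hstack_mult_vstack:
  fixes P :: "'a::semiring_1 ^ 'm ^ 'n"
  shows "hstack P V ** vstack A B = P ** A + V ** B"
  by (simp add: vec_eq_iff hstack_def vstack_def matrix_matrix_mult_def sum.Plus flip: UNIV_Plus_UNIV)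

lemma vstack_mult_hstack_eq_mat_1:
  fixes A :: "'a::semiring_1 ^ 'n ^ 'm" and B :: "'a ^ 'n ^ 'k"
  assumes "vstack A B ** hstack P V = mat 1"
  shows "A ** V = 0" and "B ** V = mat 1"
proof -
  have "(vstack A B ** hstack P V) $ Inl i $ Inr j = 0" for i j
    by (simp add: assms mat_def)
  then show "A ** V = 0"
    by (simp add: vec_eq_iff hstack_def vstack_def matrix_matrix_mult_def)
  have "(vstack A B ** hstack P V) $ Inr i $ Inr j = mat 1 $ i $ j" for i j
    by (simp add: assms mat_def)
  then show "B ** V = mat 1"
    by (simp add: vec_eq_iff hstack_def vstack_def matrix_matrix_mult_def)
qed

lemma hstack_exhaust:
  fixes Q :: "'a ^ ('m::finite + 'k::finite) ^ 'n"
  obtains P V where "Q = hstack P V"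
proof
  show "Q = hstack (\<chi> i j. Q $ i $ Inl j) (\<chi> i j. Q $ i $ Inr j)"
    by (simp add: vec_eq_iff hstack_def split: sum.split)
qed

text \<open>The cardinality condition makes the stacked matrix square, so the two factors commute
  and the blocks can be read off the product in the reverse order.\<close>

lemma hstack_left_inverse:
  fixes H :: "real ^ 'n ^ 'm" and \<phi> :: "real ^ 'n ^ 'k"
  assumes "CARD('m) + CARD('k) = CARD('n)" and "hstack P V ** vstack H \<phi> = mat 1"
  shows "vstack H \<phi> ** hstack P V = mat 1" and "H ** V = 0" and "\<phi> ** V = mat 1"
proof -
  show right: "vstack H \<phi> ** hstack P V = mat 1"
    using assms(1) by (intro left_inverse_imp_right_inverse[OF _ assms(2)]) simp
  show "H ** V = 0" and "\<phi> ** V = mat 1"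
    using vstack_mult_hstack_eq_mat_1[OF right] .
qed

section \<open>Annihilators of \<open>G\<close> at a single point\<close>

lemma block_inverse_projection:
  fixes H :: "real ^ 'n ^ 'm" and \<phi> :: "real ^ 'n ^ 'k" and G :: "real ^ 'm ^ 'n"
  assumes "hstack P V ** vstack H \<phi> = mat 1"
    and "\<phi> ** G = 0" and "invertible (H ** G)"
  shows "V ** \<phi> = mat 1 - G ** matrix_inv (H ** G) ** H"
proof -
  have sum: "P ** H + V ** \<phi> = mat 1"
    using assms(1) by (simp add: hstack_mult_vstack)
  have "G = (P ** H + V ** \<phi>) ** G"
    by (simp add: sum)
  also have "\<dots> = P ** (H ** G)"
    by (simp add: matrix_add_rdistrib assms(2) flip: matrix_mul_assoc)
  \<comment> \<open>Right multiplication by the inverse of \<open>H ** G\<close> isolates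
    \<open>P\<close>.\<close>
  finally have "P = G ** matrix_inv (H ** G)"
    by (metis assms(3) matrix_inv_mult(1) matrix_mul_assoc matrix_mul_rid)
  then show ?thesis
    using sum by (simp add: eq_diff_eq add.commute)
qed

text \<open>Reassociating exposes the factor \<open>\<psi> ** G\<close>. For \<open>X\<close> the
  inverse of an invertible \<open>H ** G\<close>, the bracket is the projection onto the kernel of
  \<open>H\<close> along the range of \<open>G\<close>.\<close>

lemma annihilator_mult_projection:
  fixes H :: "real ^ 'n ^ 'm" and \<psi> :: "real ^ 'n ^ 'k" and G :: "real ^ 'm ^ 'n"
  assumes "\<psi> ** G = 0"
  shows "\<psi> ** (mat 1 - G ** X ** H) = \<psi>"
  by (simp add: matrix_diff_ldistrib matrix_mul_assoc assms)

lemma annihilator_eq_pinv: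
  fixes H :: "real ^ 'n ^ 'm" and \<phi> :: "real ^ 'n ^ 'k" and G :: "real ^ 'm ^ 'n"
  assumes card: "CARD('m) + CARD('k) = CARD('n)"
    and inv: "hstack P V ** vstack H \<phi> = mat 1"
    and ann: "\<phi> ** G = 0" and \<Gamma>: "invertible (H ** G)"
  shows "\<phi> = pinv V ** (mat 1 - G ** matrix_inv (H ** G) ** H)"
proof -
  have "pinv V ** (V ** \<phi>) = \<phi>"
    by (simp add: matrix_mul_assoc pinv_left_inverse[OF hstack_left_inverse(3)[OF card inv]])
  then show ?thesis
    by (simp add: block_inverse_projection[OF inv ann \<Gamma>])
qed

text \<open>The bracket already kills \<open>G\<close>, so the product vanishes whatever value
  \<open>pinv V\<close> has. This supplies the annihilation condition when a function is given by
  the formula.\<close>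

lemma pinv_mult_annihilates:
  fixes H :: "real ^ 'n ^ 'm" and G :: "real ^ 'm ^ 'n"
  assumes "invertible (H ** G)"
  shows "pinv V ** (mat 1 - G ** matrix_inv (H ** G) ** H) ** G = 0"
proof -
  have "G ** matrix_inv (H ** G) ** H ** G = G ** (matrix_inv (H ** G) ** (H ** G))"
    by (simp only: matrix_mul_assoc)
  then have "(mat 1 - G ** matrix_inv (H ** G) ** H) ** G = 0"
    by (simp add: matrix_diff_rdistrib matrix_inv_mult(2)[OF assms])
  then show ?thesis
    by (simp flip: matrix_mul_assoc)
qed

lemma obtain_block_left_inverse:
  fixes H :: "real ^ 'n ^ 'm" and \<phi> :: "real ^ 'n ^ 'k"
  assumes "invertible (vstack H \<phi>)"
  obtains P V where "hstack P V ** vstack H \<phi> = mat 1"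
  by (metis assms hstack_exhaust invertible_def)

lemma annihilators_left_equivalent:
  fixes H :: "real ^ 'n ^ 'm" and \<phi> \<psi> :: "real ^ 'n ^ 'k" and G :: "real ^ 'm ^ 'n"
  assumes card: "CARD('m) + CARD('k) = CARD('n)"
    and "invertible (vstack H \<phi>)" and \<phi>: "\<phi> ** G = 0"
    and "invertible (vstack H \<psi>)" and \<psi>: "\<psi> ** G = 0"
    and \<Gamma>: "invertible (H ** G)"
  shows "\<exists>R. invertible R \<and> \<psi> = matrix_inv R ** \<phi>"
proof -
  obtain P V where PV: "hstack P V ** vstack H \<phi> = mat 1"
    using assms obtain_block_left_inverse by blast
  obtain Q W where QW: "hstack Q W ** vstack H \<psi> = mat 1"
    using assms obtain_block_left_inverse by blast
  \<comment> \<open>\<open>V ** \<phi>\<close> and \<open>W ** \<psi>\<close> are the same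
    projection, and both annihilators are fixed by it.\<close>
  have \<psi>V: "\<psi> ** V ** \<phi> = \<psi>"
    using block_inverse_projection[OF PV \<phi> \<Gamma>] annihilator_mult_projection[OF \<psi>]
    by (simp flip: matrix_mul_assoc)
  have \<phi>W: "\<phi> ** W ** \<psi> = \<phi>"
    using block_inverse_projection[OF QW \<psi> \<Gamma>] annihilator_mult_projection[OF \<phi>]
    by (simp flip: matrix_mul_assoc)
  \<comment> \<open>The products collapse to \<open>\<phi> ** V\<close> and
    \<open>\<psi> ** W\<close>. The witness for \<open>R\<close> is \<open>\<phi> ** W\<close>,
    because its inverse \<open>\<psi> ** V\<close> is what carries \<open>\<phi>\<close> to
    \<open>\<psi>\<close>.\<close>
  have "(\<phi> ** W) ** (\<psi> ** V) = mat 1" "(\<psi> ** V) ** (\<phi> ** W) = mat 1"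
    by (simp_all add: matrix_mul_assoc \<psi>V \<phi>W hstack_left_inverse(3)[OF card PV]
        hstack_left_inverse(3)[OF card QW])
  then have "invertible (\<phi> ** W)" "matrix_inv (\<phi> ** W) = \<psi> ** V"
    by (auto simp: invertible_def intro: matrix_inv_unique)
  then show ?thesis
    using \<psi>V by metis
qed

text \<open>"All functions are given by" is read as an equivalence in the second conjunct. The third
  makes the formula hold for every block inverse, not just a chosen one, and the full rank of
  \<open>V x\<close> ensures that \<open>pinv\<close> is the actual pseudoinverse.\<close>

theorem lemma3p2:
  fixes M :: "real ^ 'n \<Rightarrow> real ^ 'n ^ 'n"
    and B :: "real ^ 'n \<Rightarrow> real ^ 'm ^ 'n"
    and h :: "real ^ 'n \<Rightarrow> real ^ 'm"
    and U :: "(real ^ 'n) set"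
  assumes "1 \<le> CARD('m)" and "CARD('m) < CARD('n)"
    and "CARD('k) = CARD('n) - CARD('m)"
    and "continuous_on UNIV M" and "\<And>q. invertible (M q)"
    and "continuous_on UNIV B"
    and "C1_map h"
    and "open U" and "\<And>x. x \<in> U \<Longrightarrow> invertible (Gam M B h x)"
  shows
    "(\<forall>\<phi> \<psi> :: real ^ 'n \<Rightarrow> real ^ 'n ^ 'k.
        admissible M B h U \<phi> \<and> admissible M B h U \<psi> \<longrightarrow>
        (\<exists>R :: real ^ 'n \<Rightarrow> real ^ 'k ^ 'k.
          \<forall>x\<in>U. invertible (R x) \<and> \<psi> x = matrix_inv (R x) ** \<phi> x))
   \<and> (\<forall>\<phi> :: real ^ 'n \<Rightarrow> real ^ 'n ^ 'k.
        admissible M B h U \<phi> \<longleftrightarrow>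
        (\<exists>(V :: real ^ 'n \<Rightarrow> real ^ 'k ^ 'n) (P :: real ^ 'n \<Rightarrow> real ^ 'm ^ 'n).
          \<forall>x\<in>U. hstack (P x) (V x) ** vstack (jacobian h (at x)) (\<phi> x) = mat 1 \<and>
            \<phi> x = pinv (V x) **
              (mat 1 - matrix_inv (M x) ** B x ** matrix_inv (Gam M B h x) ** jacobian h (at x))))
   \<and> (\<forall>(\<phi> :: real ^ 'n \<Rightarrow> real ^ 'n ^ 'k)
        (V :: real ^ 'n \<Rightarrow> real ^ 'k ^ 'n) (P :: real ^ 'n \<Rightarrow> real ^ 'm ^ 'n).
        admissible M B h U \<phi> \<and>
        (\<forall>x\<in>U. hstack (P x) (V x) ** vstack (jacobian h (at x)) (\<phi> x) = mat 1) \<longrightarrow>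
        (\<forall>x\<in>U. rank (V x) = CARD('k) \<and> invertible (transpose (V x) ** V x) \<and>
          \<phi> x = pinv (V x) **
            (mat 1 - matrix_inv (M x) ** B x ** matrix_inv (Gam M B h x) ** jacobian h (at x))))"
proof -
  define H where "H x = jacobian h (at x)" for x
  define G where "G x = matrix_inv (M x) ** B x" for x
  \<comment> \<open>Subtraction of naturals is truncated; \<open>m < n\<close> permits the additive
    form.\<close>
  have card: "CARD('m) + CARD('k) = CARD('n)"
    using assms(2,3) by simp
  have Gam: "Gam M B h x = H x ** G x" for x
    by (simp add: Gam_def H_def G_def matrix_mul_assoc)
  have \<Gamma>: "invertible (H x ** G x)" if "x \<in> U" for x
    using assms(9)[OF that] by (simp add: Gam)
  have adm: "admissible M B h U \<phi> \<longleftrightarrow>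
      (\<forall>x\<in>U. invertible (vstack (H x) (\<phi> x)) \<and> \<phi> x ** G x = 0)"
    for \<phi> :: "real ^ 'n \<Rightarrow> real ^ 'n ^ 'k"
    by (simp add: admissible_def H_def G_def matrix_mul_assoc)
  note formula = annihilator_eq_pinv[OF card _ _ \<Gamma>]
  show ?thesis
    unfolding adm Gam H_def[symmetric] G_def[symmetric]
  proof (intro conjI allI impI)
    fix \<phi> \<psi> :: "real ^ 'n \<Rightarrow> real ^ 'n ^ 'k"
    assume "(\<forall>x\<in>U. invertible (vstack (H x) (\<phi> x)) \<and> \<phi> x ** G x = 0) \<and>
      (\<forall>x\<in>U. invertible (vstack (H x) (\<psi> x)) \<and> \<psi> x ** G x = 0)"
    \<comment> \<open>No regularity of \<open>R\<close> in \<open>x\<close> is claimed, so a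
      pointwise choice suffices.\<close>
    then have "\<forall>x\<in>U. \<exists>R. invertible R \<and> \<psi> x = matrix_inv R ** \<phi> x"
      using annihilators_left_equivalent[OF card] \<Gamma> by blast
    then show "\<exists>R. \<forall>x\<in>U. invertible (R x) \<and> \<psi> x = matrix_inv (R x) ** \<phi> x"
      by (rule bchoice)
  next
    fix \<phi> :: "real ^ 'n \<Rightarrow> real ^ 'n ^ 'k"
    show "(\<forall>x\<in>U. invertible (vstack (H x) (\<phi> x)) \<and> \<phi> x ** G x = 0) \<longleftrightarrow>
      (\<exists>V P. \<forall>x\<in>U. hstack (P x) (V x) ** vstack (H x) (\<phi> x) = mat 1 \<and>
        \<phi> x = pinv (V x) ** (mat 1 - G x ** matrix_inv (H x ** G x) ** H x))"
      (is "?adm \<longleftrightarrow> ?rep")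
    proof
      assume ?adm
      then have "\<forall>x\<in>U. \<exists>V P. hstack P V ** vstack (H x) (\<phi> x) = mat 1"
        using obtain_block_left_inverse by metis
      then obtain V P where "\<forall>x\<in>U. hstack (P x) (V x) ** vstack (H x) (\<phi> x) = mat 1"
        by metis
      then show ?rep
        using \<open>?adm\<close> formula by blast
    next
      \<comment> \<open>The block identity gives invertibility, and the formula gives annihilation
        of \<open>G x\<close>.\<close>
      assume ?rep
      then obtain V P where inv: "hstack (P x) (V x) ** vstack (H x) (\<phi> x) = mat 1"
        and rep: "\<phi> x = pinv (V x) ** (mat 1 - G x ** matrix_inv (H x ** G x) ** H x)"
        if "x \<in> U" for x
        by blast
      show ?adm
      proof (intro ballI conjI)
        fix x assume x: "x \<in> U"
        show "invertible (vstack (H x) (\<phi> x))"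
          using inv[OF x] hstack_left_inverse(1)[OF card inv[OF x]] by (auto simp: invertible_def)
        show "\<phi> x ** G x = 0"
          using rep[OF x] pinv_mult_annihilates[OF \<Gamma>[OF x]] by metis
      qed
    qed
  next
    fix \<phi> :: "real ^ 'n \<Rightarrow> real ^ 'n ^ 'k"
      and V :: "real ^ 'n \<Rightarrow> real ^ 'k ^ 'n" and P :: "real ^ 'n \<Rightarrow> real ^ 'm ^ 'n"
    assume asm: "(\<forall>x\<in>U. invertible (vstack (H x) (\<phi> x)) \<and> \<phi> x ** G x = 0) \<and>
      (\<forall>x\<in>U. hstack (P x) (V x) ** vstack (H x) (\<phi> x) = mat 1)"
    show "\<forall>x\<in>U. rank (V x) = CARD('k) \<and> invertible (transpose (V x) ** V x) \<and>
      \<phi> x = pinv (V x) ** (mat 1 - G x ** matrix_inv (H x ** G x) ** H x)"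
    proof (intro ballI conjI)
      fix x assume x: "x \<in> U"
      with asm have left: "\<phi> x ** V x = mat 1"
        using hstack_left_inverse(3)[OF card] by blast
      show "rank (V x) = CARD('k)"
        using left full_rank_injective matrix_left_invertible_injective by blast
      show "invertible (transpose (V x) ** V x)"
        by (rule left_inverse_imp_invertible_gram[OF left])
      show "\<phi> x = pinv (V x) ** (mat 1 - G x ** matrix_inv (H x ** G x) ** H x)"
        using asm x formula by blast
    qed
  qed
qed

end
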